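(* Let $N,m\ge 1$ be integers and $\eta>0$. The LFG algorithm with parameter $\eta$ is feasibility-optimal: for every vector $\mathbf r=(r_1,\dots,r_N)\in(0,1)^N$ strictly inside the maximal feasibility region $\mathcal C$, the actions $d_i(t)$ of LFG run with $\mathbf r$ satisfy $$\liminf_{T\to\infty}\frac1T\sum_{t=0}^{T-1}\mathbb E[d_i(t)]\ge r_i\qquad\text{for all } i\in\{1,\dots,N\}.$$ Specifically, for every such $\mathbf r$ the virtual queue system is strongly stable under LFG: if $\epsilon>0$ is a constant such that $\mathbf r+\epsilon\mathbf 1$ is still strictly inside $\mathcal C$, where $\mathbf 1$ is the $N$-dimensional all-ones vector, then $$\limsup_{T\to\infty}\frac1T\sum_{t=0}^{T-1}\mathbb E\Big[\sum_{i=1}^N Q_i(t)\Big]\le \frac{B}{\epsilon}<\infty,\qquad B:=\frac N2+\eta\, m\, w_{\max}.$$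
   Context: **Model.** There are $N$ arms, $\mathcal N=\{1,\dots,N\}$, and rounds $t=0,1,2,\dots$. In round $t$ arm $i$ has a random reward $X_i(t)\in[0,1]$ with mean $\mu_i$, and $A(t)\subseteq\mathcal N$ is the random set of available arms, with distribution $P_{\mathbf A}(Z)=P(A(t)=Z)$ for $Z\subseteq\mathcal N$. Rewards and availability are i.i.d. over time: the pairs $\big(A(t),(X_1(t),\dots,X_N(t))\big)$, $t\ge0$, are i.i.d. The weights $w_i$ are fixed positive numbers with $w_i\le w_{\max}<\infty$. For $Z\subseteq\mathcal N$ let $\mathcal S(Z)=\{S\subseteq Z:|S|\le m\}$ (the feasible super arms). In each round $t$ the player observes $A(t)$, then selects a super arm $S(t)\in\mathcal S(A(t))$, and then observes $X_i(t)$ for $i\in S(t)$. Set $d_i(t)=1$ if $i\in S(t)$ and $d_i(t)=0$ otherwise. **Feasibility.** A vector $\mathbf r\in(0,1)^N$ is feasible if there exists a policy (a rule making decisions $S(t)\in\mathcal S(A(t))$, possibly randomized, for $t\ge0$) such that $\liminf_{T\to\infty}\frac1T\sum_{t=0}^{T-1}\mathbb E[d_i(t)]\ge r_i$ for all $i\in\mathcal N$. The maximal feasibility region $\mathcal C$ is the set of all feasible vectors in $(0,1)^N$. "Strictly inside $\mathcal C$" means in the interior of $\mathcal C$. A policy is feasibility-optimal if the constraints $\liminf_{T\to\infty}\frac1T\sum_{t=0}^{T-1}\mathbb E[d_i(t)]\ge r_i$ for all $i\in\mathcal N$ are satisfied for every $\mathbf r$ strictly inside $\mathcal C$. **LFG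 (Learning with Fairness Guarantee) algorithm**, with parameter $\eta>0$ and input $\mathbf r$. Let $h_i(t)=\sum_{k=0}^t d_i(k)$, $h_i(-1)=0$, and, when $h_i(t)>0$, let $\hat\mu_i(t)=\frac{1}{h_i(t)}\sum_{k=0}^t X_i(k)d_i(k)$. The UCB estimate is $$\bar\mu_i(t)=\min\Big\{\hat\mu_i(t-1)+\sqrt{\tfrac{3\log t}{2h_i(t-1)}},\,1\Big\}\ \text{ if } h_i(t-1)>0,\qquad \bar\mu_i(t)=1\ \text{ if } h_i(t-1)=0.$$ The virtual queue lengths are $Q_i(0)=0$ and $Q_i(t)=\max\{Q_i(t-1)+r_i-d_i(t-1),0\}$ for $t\ge1$. In each round $t$, after observing $A(t)$, LFG plays a super arm $$S(t)\in\arg\max_{S\in\mathcal S(A(t))}\sum_{i\in S}\big(Q_i(t)+\eta w_i\bar\mu_i(t)\big),$$ with ties broken arbitrarily based only on information available at that time (the past observations and $A(t)$, and possibly independent randomization). *)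

theory Defs
  imports "HOL-Probability.Probability"
begin

text \<open>
  The arms are the elements of a finite type \<open>'n\<close>, so that \<open>N = CARD('n)\<close> and vectors indexed
  by arms have type \<open>real ^ 'n\<close>.  A super arm is a set of arms.
\<close>

definition super_arms :: "nat \<Rightarrow> 'n::finite set \<Rightarrow> 'n set set" where
  "super_arms m Z = {S. S \<subseteq> Z \<and> card S \<le> m}"

text \<open>
  The observation made in one round consists of the available arms, the super arm played, and the
  rewards of the arms played (semi-bandit feedback; the rewards of all other arms are masked by 0).
\<close>

type_synonym 'n obs = "'n set \<times> 'n set \<times> (real ^ 'n)"

abbreviation obs_space :: "'n::finite obs measure" where
  "obs_space \<equiv> count_space UNIV \<Otimes>\<^sub>M count_space UNIV \<Otimes>\<^sub>M borel"

definition feedback :: "'n::finite set \<Rightarrow> real ^ 'n \<Rightarrow> real ^ 'n" where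
  "feedback S x = (\<chi> i. if i \<in> S then x $ i else 0)"

text \<open>
  In round \<open>t\<close> a policy maps a random seed, the observations of the rounds \<open>k < t\<close> and the set of
  available arms to a super arm.  The seed is a uniform random number, independent of rewards and
  availability, that the policy may use in all rounds; it accounts for all internal randomization.
\<close>

type_synonym 'n policy = "nat \<Rightarrow> real \<Rightarrow> (nat \<Rightarrow> 'n obs) \<Rightarrow> 'n set \<Rightarrow> 'n set"

definition admissible_policy :: "nat \<Rightarrow> 'n::finite policy \<Rightarrow> bool" where
  "admissible_policy m \<pi> \<longleftrightarrow>
     (\<forall>t. (\<lambda>(u, h, Z). \<pi> t u h Z) \<in>
        borel \<Otimes>\<^sub>M (\<Pi>\<^sub>M k\<in>{..<t}. obs_space) \<Otimes>\<^sub>M count_space UNIV \<rightarrow>\<^sub>M count_space UNIV) \<and>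
     (\<forall>t u h Z. \<pi> t u h Z \<in> super_arms m Z)"

text \<open>
  The run of a policy for a seed \<open>u\<close>, availabilities \<open>a\<close> and rewards \<open>x\<close>: \<open>history \<pi> u a x t\<close> holds
  the observations of the rounds \<open>k < t\<close> and is \<open>undefined\<close> at all \<open>k \<ge> t\<close>, as required for an
  element of the product space over \<open>{..<t}\<close>.
\<close>

primrec history ::
  "'n::finite policy \<Rightarrow> real \<Rightarrow> (nat \<Rightarrow> 'n set) \<Rightarrow> (nat \<Rightarrow> real ^ 'n) \<Rightarrow> nat \<Rightarrow> nat \<Rightarrow> 'n obs" where
  "history \<pi> u a x 0 = (\<lambda>_. undefined)"
| "history \<pi> u a x (Suc t) =
     (let S = \<pi> t u (history \<pi> u a x t) (a t)
      in (history \<pi> u a x t)(t := (a t, S, feedback S (x t))))"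

definition played ::
  "'n::finite policy \<Rightarrow> real \<Rightarrow> (nat \<Rightarrow> 'n set) \<Rightarrow> (nat \<Rightarrow> real ^ 'n) \<Rightarrow> nat \<Rightarrow> 'n set" where
  "played \<pi> u a x t = \<pi> t u (history \<pi> u a x t) (a t)"

text \<open>
  Quantities determined by a sequence \<open>S\<close> of super arms and a sequence \<open>x\<close> of reward vectors.
  The index of \<open>pulls\<close> and \<open>emp_mean\<close> is shifted by one: at \<open>t\<close> they are
  \<open>h\<^sub>i(t - 1)\<close> and \<open>\<mu>\<^sub>i(t - 1)\<close> (the empirical mean), i.e. they take the rounds
  \<open>0, \<dots>, t - 1\<close> into account.
\<close>

definition decision :: "(nat \<Rightarrow> 'n::finite set) \<Rightarrow> 'n \<Rightarrow> nat \<Rightarrow> real" where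
  "decision S i t = (if i \<in> S t then 1 else 0)"

definition pulls :: "(nat \<Rightarrow> 'n::finite set) \<Rightarrow> 'n \<Rightarrow> nat \<Rightarrow> real" where
  "pulls S i t = (\<Sum>k<t. decision S i k)"

definition emp_mean :: "(nat \<Rightarrow> 'n::finite set) \<Rightarrow> (nat \<Rightarrow> real ^ 'n) \<Rightarrow> 'n \<Rightarrow> nat \<Rightarrow> real" where
  "emp_mean S x i t = (\<Sum>k<t. x k $ i * decision S i k) / pulls S i t"

definition ucb :: "(nat \<Rightarrow> 'n::finite set) \<Rightarrow> (nat \<Rightarrow> real ^ 'n) \<Rightarrow> 'n \<Rightarrow> nat \<Rightarrow> real" where
  "ucb S x i t =
     (if pulls S i t > 0
      then min (emp_mean S x i t + sqrt (3 * ln (real t) / (2 * pulls S i t))) 1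
      else 1)"

primrec queue :: "real ^ 'n \<Rightarrow> (nat \<Rightarrow> 'n::finite set) \<Rightarrow> 'n \<Rightarrow> nat \<Rightarrow> real" where
  "queue r S i 0 = 0"
| "queue r S i (Suc t) = max (queue r S i t + r $ i - decision S i t) 0"

text \<open>
  The stochastic environment: \<open>A t\<close> and \<open>X t\<close> are the available arms and the reward vector of
  round \<open>t\<close>, \<open>U\<close> is the seed for randomized policies, and \<open>m\<close> is the maximal size of super arms.
  Within a round, \<open>A t\<close> and the components of \<open>X t\<close> may be dependent.
\<close>

locale bandit = prob_space M for M :: "'w measure" +
  fixes A :: "nat \<Rightarrow> 'w \<Rightarrow> 'n::finite set"
    and X :: "nat \<Rightarrow> 'w \<Rightarrow> real ^ 'n"
    and U :: "'w \<Rightarrow> real"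
    and m :: nat
  assumes A_measurable: "A t \<in> M \<rightarrow>\<^sub>M count_space UNIV"
    and X_measurable: "X t \<in> borel_measurable M"
    and X_range: "\<omega> \<in> space M \<Longrightarrow> X t \<omega> $ i \<in> {0..1}"
    and env_indep: "indep_vars (\<lambda>_. count_space UNIV \<Otimes>\<^sub>M borel) (\<lambda>t \<omega>. (A t \<omega>, X t \<omega>)) UNIV"
    and env_identical:
      "distr M (count_space UNIV \<Otimes>\<^sub>M borel) (\<lambda>\<omega>. (A t \<omega>, X t \<omega>)) =
       distr M (count_space UNIV \<Otimes>\<^sub>M borel) (\<lambda>\<omega>. (A 0 \<omega>, X 0 \<omega>))"
    and U_measurable: "U \<in> borel_measurable M"
    and U_uniform: "distr M borel U = uniform_measure lborel {0..1}"
    and U_indep: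
      "indep_set
         (sets (vimage_algebra (space M) U borel))
         (sets (vimage_algebra (space M) (\<lambda>\<omega> t. (A t \<omega>, X t \<omega>))
                  (\<Pi>\<^sub>M t\<in>UNIV. count_space UNIV \<Otimes>\<^sub>M borel)))"
    and m_pos: "m \<ge> 1"
begin

definition arms :: "'n policy \<Rightarrow> 'w \<Rightarrow> nat \<Rightarrow> 'n set" where
  "arms \<pi> \<omega> = played \<pi> (U \<omega>) (\<lambda>t. A t \<omega>) (\<lambda>t. X t \<omega>)"

definition fairness :: "real ^ 'n \<Rightarrow> 'n policy \<Rightarrow> bool" where
  "fairness r \<pi> \<longleftrightarrow>
     (\<forall>i. liminf (\<lambda>T. ereal ((\<Sum>t<T. expectation (\<lambda>\<omega>. decision (arms \<pi> \<omega>) i t)) / real T))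
           \<ge> ereal (r $ i))"

definition feasible_region :: "(real ^ 'n) set" where
  "feasible_region =
     {r. (\<forall>i. 0 < r $ i \<and> r $ i < 1) \<and> (\<exists>\<pi>. admissible_policy m \<pi> \<and> fairness r \<pi>)}"

text \<open>Here a policy may take the vector \<open>r\<close> as an input.\<close>

definition feasibility_optimal :: "(real ^ 'n \<Rightarrow> 'n policy) \<Rightarrow> bool" where
  "feasibility_optimal pol \<longleftrightarrow> (\<forall>r \<in> interior feasible_region. fairness r (pol r))"

definition avg_queue :: "real ^ 'n \<Rightarrow> 'n policy \<Rightarrow> ereal" where
  "avg_queue r \<pi> =
     limsup (\<lambda>T. ereal ((\<Sum>t<T. expectation (\<lambda>\<omega>. \<Sum>i\<in>UNIV. queue r (arms \<pi> \<omega>) i t)) / real T))"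

definition strongly_stable :: "real ^ 'n \<Rightarrow> 'n policy \<Rightarrow> bool" where
  "strongly_stable r \<pi> \<longleftrightarrow> avg_queue r \<pi> < \<infinity>"

text \<open>
  LFG breaks ties arbitrarily, so it is a property of policies.  Admissibility makes the
  tie-breaking rule depend only on past observations, the available arms and the seed.
\<close>

definition LFG :: "real \<Rightarrow> ('n \<Rightarrow> real) \<Rightarrow> real ^ 'n \<Rightarrow> 'n policy \<Rightarrow> bool" where
  "LFG \<eta> w r \<pi> \<longleftrightarrow>
     admissible_policy m \<pi> \<and>
     (\<forall>\<omega>\<in>space M. \<forall>t.
        is_arg_max
          (\<lambda>S. \<Sum>i\<in>S. queue r (arms \<pi> \<omega>) i t + \<eta> * w i * ucb (arms \<pi> \<omega>) (\<lambda>k. X k \<omega>) i t)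
          (\<lambda>S. S \<in> super_arms m (A t \<omega>))
          (arms \<pi> \<omega> t))"

end

end

theory Submission
  imports Defs
begin

text \<open>
  The proof is a Lyapunov drift argument for half the sum of the squared queue lengths.  The UCB
  terms lie in \<open>[0, 1]\<close>, so LFG maximizes \<open>\<Sum>i\<in>S. Q\<^sub>i(t)\<close> up to an error of at most
  \<open>\<eta> m w_max\<close>.  The queue lengths \<open>Q(t)\<close> depend only on the seed and on the rounds before \<open>t\<close>,
  hence are independent of \<open>A(t)\<close>, and the expected maximal weight is at least
  \<open>\<Sum>i. E Q\<^sub>i(t) r'\<^sub>i\<close> for every feasible \<open>r'\<close>.  Taking \<open>r' = r + \<epsilon> 1\<close> and telescoping
  bounds the average queue length; taking \<open>r' = r\<close> gives \<open>E Q\<^sub>i(T) = O(\<surd>T)\<close>, which implies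
  fairness because \<open>Q\<^sub>i(T)\<close> is at least the accumulated deficit of arm \<open>i\<close>.
\<close>

section \<open>Measurability of runs and their dependence on the past\<close>

abbreviation env_space :: "('n::finite set \<times> (real ^ 'n)) measure" where
  "env_space \<equiv> count_space UNIV \<Otimes>\<^sub>M borel"

text \<open>For a fixed super arm the masking is linear, hence continuous. A measurable super arm
  takes only finitely many values, so these cases can be glued together.\<close>

lemma measurable_feedback:
  fixes x :: "'w \<Rightarrow> real ^ 'n"
  assumes S: "S \<in> N \<rightarrow>\<^sub>M count_space UNIV" and x: "x \<in> borel_measurable N"
  shows "(\<lambda>\<omega>. feedback (S \<omega>) (x \<omega>)) \<in> borel_measurable N"
proof -
  have "feedback T \<in> borel_measurable borel" for T :: "'n set"
    unfolding feedback_def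
    by (intro borel_measurable_continuous_onI linear_continuous_on)
       (auto intro!: linear_conv_bounded_linear[THEN iffD1] linearI simp: vec_eq_iff)
  then have "(\<lambda>\<omega>. feedback T (x \<omega>)) \<in> borel_measurable N" for T
    using measurable_compose[OF x] by blast
  then show ?thesis
    using S by (rule measurable_compose_countable)
qed

text \<open>The domain \<open>N\<close> is kept general because, through
  \<open>measurable_played\<close>, the result serves two purposes: the run on \<open>M\<close>, and
  the run as a function of the seed and finitely many rounds of the environment. In the second use
  only early rounds are available as coordinates, hence the bounds on \<open>k\<close>.\<close>

lemma measurable_history:
  assumes \<pi>: "admissible_policy m \<pi>" and u: "u \<in> borel_measurable N"
    and "\<And>k. k < t \<Longrightarrow> a k \<in> N \<rightarrow>\<^sub>M count_space UNIV"
    and "\<And>k. k < t \<Longrightarrow> x k \<in> borel_measurable N"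
  shows "(\<lambda>\<omega>. history \<pi> (u \<omega>) (\<lambda>k. a k \<omega>) (\<lambda>k. x k \<omega>) t) \<in> N \<rightarrow>\<^sub>M (\<Pi>\<^sub>M k\<in>{..<t}. obs_space)"
  using assms(3,4)
proof (induction t)
  case 0
  \<comment> \<open>The constant \<open>undefined\<close> function is the only point of the empty
    product.\<close>
  show ?case by (simp add: PiM_empty)
next
  case (Suc t)
  let ?h = "\<lambda>\<omega>. history \<pi> (u \<omega>) (\<lambda>k. a k \<omega>) (\<lambda>k. x k \<omega>) t"
  let ?S = "\<lambda>\<omega>. \<pi> t (u \<omega>) (?h \<omega>) (a t \<omega>)"
  have h [measurable]: "?h \<in> N \<rightarrow>\<^sub>M (\<Pi>\<^sub>M k\<in>{..<t}. obs_space)"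
    using Suc by simp
  have [measurable]: "a t \<in> N \<rightarrow>\<^sub>M count_space UNIV" "x t \<in> borel_measurable N"
    using Suc.prems by simp_all
  note u [measurable]
  have "(\<lambda>(u, h, Z). \<pi> t u h Z) \<in>
      borel \<Otimes>\<^sub>M (\<Pi>\<^sub>M k\<in>{..<t}. obs_space) \<Otimes>\<^sub>M count_space UNIV \<rightarrow>\<^sub>M count_space UNIV"
    using \<pi> by (auto simp: admissible_policy_def)
  from measurable_compose[OF _ this, of "\<lambda>\<omega>. (u \<omega>, ?h \<omega>, a t \<omega>)" N]
  have [measurable]: "?S \<in> N \<rightarrow>\<^sub>M count_space UNIV" by simp
  have [measurable]: "(\<lambda>\<omega>. feedback (?S \<omega>) (x t \<omega>)) \<in> borel_measurable N"
    by (rule measurable_feedback) simp_all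
  have "(\<lambda>\<omega>. (?h \<omega>)(t := (a t \<omega>, ?S \<omega>, feedback (?S \<omega>) (x t \<omega>)))) \<in> N \<rightarrow>\<^sub>M (\<Pi>\<^sub>M k\<in>{..<Suc t}. obs_space)"
    by (rule measurable_fun_upd[where J="{..<t}"]) (auto simp: lessThan_Suc)
  then show ?case by (simp only: history.simps Let_def)
qed

lemma measurable_played:
  assumes \<pi>: "admissible_policy m \<pi>" and u: "u \<in> borel_measurable N"
    and a: "\<And>k. k \<le> t \<Longrightarrow> a k \<in> N \<rightarrow>\<^sub>M count_space UNIV"
    and x: "\<And>k. k < t \<Longrightarrow> x k \<in> borel_measurable N"
  shows "(\<lambda>\<omega>. played \<pi> (u \<omega>) (\<lambda>k. a k \<omega>) (\<lambda>k. x k \<omega>) t) \<in> N \<rightarrow>\<^sub>M count_space UNIV"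
proof -
  let ?h = "\<lambda>\<omega>. history \<pi> (u \<omega>) (\<lambda>k. a k \<omega>) (\<lambda>k. x k \<omega>) t"
  have [measurable]: "?h \<in> N \<rightarrow>\<^sub>M (\<Pi>\<^sub>M k\<in>{..<t}. obs_space)"
    by (rule measurable_history[OF \<pi> u]) (simp_all add: a x)
  have \<pi>t: "(\<lambda>(u, h, Z). \<pi> t u h Z) \<in>
      borel \<Otimes>\<^sub>M (\<Pi>\<^sub>M k\<in>{..<t}. obs_space) \<Otimes>\<^sub>M count_space UNIV \<rightarrow>\<^sub>M count_space UNIV"
    using \<pi> by (auto simp: admissible_policy_def)
  note u [measurable] a[OF order_refl, measurable]
  from measurable_compose[OF _ \<pi>t, of "\<lambda>\<omega>. (u \<omega>, ?h \<omega>, a t \<omega>)" N]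
  show ?thesis by (simp add: played_def)
qed

lemma history_cong:
  assumes "\<And>k. k < t \<Longrightarrow> a k = a' k" "\<And>k. k < t \<Longrightarrow> x k = x' k"
  shows "history \<pi> u a x t = history \<pi> u a' x' t"
  using assms by (induction t) (simp_all add: Let_def)

text \<open>The bounds differ because a decision sees the availability of its own round but not its
  reward. This later allows the environment to be cut off after finitely many rounds.\<close>

lemma played_cong:
  assumes "\<And>k. k \<le> t \<Longrightarrow> a k = a' k" "\<And>k. k < t \<Longrightarrow> x k = x' k"
  shows "played \<pi> u a x t = played \<pi> u a' x' t"
  using assms history_cong[of t a a' x x' \<pi> u] by (simp add: played_def)

section \<open>Queue lengths and UCB terms along a fixed sequence of super arms\<close>

text \<open>The strict bound on \<open>k\<close> is the source of the independence between the queue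
  lengths at \<open>t\<close> and \<open>A t\<close>.\<close>

lemma queue_cong:
  assumes "\<And>k. k < t \<Longrightarrow> S k = S' k"
  shows "queue r S i t = queue r S' i t"
  using assms by (induction t) (simp_all add: decision_def)

lemma measurable_queue:
  assumes "\<And>k. k < t \<Longrightarrow> (\<lambda>\<omega>. S \<omega> k) \<in> N \<rightarrow>\<^sub>M count_space UNIV"
  shows "(\<lambda>\<omega>. queue r (S \<omega>) i t) \<in> borel_measurable N"
  using assms
proof (induction t)
  case (Suc t)
  then have [measurable]: "(\<lambda>\<omega>. S \<omega> t) \<in> N \<rightarrow>\<^sub>M count_space UNIV"
    "(\<lambda>\<omega>. queue r (S \<omega>) i t) \<in> borel_measurable N" by simp_all
  show ?case unfolding queue.simps decision_def by measurable
qed simp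

lemma queue_nonneg: "0 \<le> queue r S i t"
  by (cases t) auto

lemma queue_le:
  assumes "0 \<le> r $ i" "r $ i \<le> 1"
  shows "queue r S i t \<le> real t"
  using assms by (induction t) (auto simp: decision_def)

text \<open>Truncation at 0 can only raise the queue, so the plain sum of the increments stays below
  it. This is how a bound on queues becomes a bound on the deficit of an arm.\<close>

lemma queue_ge: "real t * r $ i - (\<Sum>k<t. decision S i k) \<le> queue r S i t"
  by (induction t) (auto simp: algebra_simps)

text \<open>Drop the truncation and expand the square; the squared increment is at most 1. The
  resulting \<open>1 / 2\<close> per arm adds up to the term \<open>CARD('n) / 2\<close> of the
  final constant.\<close>

lemma queue_square_step:
  assumes "0 < r $ i" "r $ i < 1"
  shows "(queue r S i (Suc t))\<^sup>2 / 2 \<le>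
    (queue r S i t)\<^sup>2 / 2 + 1 / 2 + queue r S i t * r $ i - queue r S i t * decision S i t"
proof -
  let ?q = "queue r S i t" and ?y = "r $ i - decision S i t"
  have "(max (?q + ?y) 0)\<^sup>2 \<le> (?q + ?y)\<^sup>2"
    by (auto simp: max_def)
  moreover have "\<bar>?y\<bar> \<le> 1" using assms by (auto simp: decision_def)
  then have "?y\<^sup>2 \<le> 1" by (simp add: abs_square_le_1)
  moreover have "(?q + ?y)\<^sup>2 = ?q\<^sup>2 + 2 * (?q * ?y) + ?y\<^sup>2"
    by (simp add: power2_eq_square algebra_simps)
  ultimately show ?thesis
    by (simp add: right_diff_distrib add_diff_eq)
qed

lemma ucb_le_1: "ucb S x i t \<le> 1"
  by (simp add: ucb_def)

lemma ucb_nonneg: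
  assumes "\<And>k. 0 \<le> x k $ i"
  shows "0 \<le> ucb S x i t"
proof (cases "pulls S i t > 0")
  case True
  \<comment> \<open>An arm that has been pulled forces \<open>t\<close> to be at least 1, so the
    logarithm under the root is nonnegative.\<close>
  then have "t \<noteq> 0" by (auto simp: pulls_def intro: ccontr)
  then have "0 \<le> sqrt (3 * ln (real t) / (2 * pulls S i t))"
    using True by simp
  moreover have "0 \<le> emp_mean S x i t"
    using True assms by (auto simp: emp_mean_def decision_def intro!: divide_nonneg_pos sum_nonneg)
  ultimately show ?thesis by (simp add: ucb_def)
qed (simp add: ucb_def)

section \<open>The maximal weight of a feasible super arm\<close>

definition max_weight :: "nat \<Rightarrow> 'n::finite set \<Rightarrow> ('n \<Rightarrow> real) \<Rightarrow> real" where
  "max_weight m Z q = Max (sum q ` super_arms m Z)"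

lemma super_arms_nonempty: "super_arms m Z \<noteq> {}"
  by (auto simp: super_arms_def intro: exI[of _ "{}"])

lemma sum_le_max_weight: "S \<in> super_arms m Z \<Longrightarrow> sum q S \<le> max_weight m Z q"
  unfolding max_weight_def by (rule Max_ge) auto

lemma max_weight_le: "(\<And>S. S \<in> super_arms m Z \<Longrightarrow> sum q S \<le> c) \<Longrightarrow> max_weight m Z q \<le> c"
  using super_arms_nonempty[of m Z] by (auto simp: max_weight_def)

text \<open>The empty super arm is always feasible and has weight 0, whatever the signs of
  \<open>q\<close>.\<close>

lemma max_weight_nonneg: "0 \<le> max_weight m Z q"
  using sum_le_max_weight[of "{}" m Z q] by (simp add: super_arms_def)

lemma measurable_max_weight:
  assumes "\<And>i. (\<lambda>\<omega>. q \<omega> i) \<in> borel_measurable N"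
  shows "(\<lambda>\<omega>. max_weight m Z (q \<omega>)) \<in> borel_measurable N"
proof -
  have "(\<lambda>\<omega>. Max ((\<lambda>S. sum (q \<omega>) S) ` super_arms m Z)) \<in> borel_measurable N"
    using assms by (intro borel_measurable_Max borel_measurable_sum) auto
  then show ?thesis by (simp add: max_weight_def)
qed

section \<open>Independence of an event from a pair of random variables\<close>

text \<open>The preimages of boxes form an intersection-stable generator of the sigma algebra of the
  pair, so independence on boxes extends to every measurable function of the pair. The hypothesis
  speaks of joint boxes because independence from \<open>U\<close> and from \<open>W\<close>
  separately would not give independence from the pair.\<close>

lemma (in prob_space) expectation_indicator_times_indep:
  fixes G :: "'b \<times> 'c \<Rightarrow> real"
  assumes F: "F \<in> events" and U: "U \<in> M \<rightarrow>\<^sub>M T" and W: "W \<in> M \<rightarrow>\<^sub>M S"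
    and indep: "\<And>B C. B \<in> sets T \<Longrightarrow> C \<in> sets S \<Longrightarrow>
      prob (F \<inter> (U -` B \<inter> W -` C \<inter> space M)) = prob F * prob (U -` B \<inter> W -` C \<inter> space M)"
    and G: "G \<in> borel_measurable (T \<Otimes>\<^sub>M S)" and int: "integrable M (\<lambda>\<omega>. G (U \<omega>, W \<omega>))"
  shows "expectation (\<lambda>\<omega>. indicator F \<omega> * G (U \<omega>, W \<omega>)) = prob F * expectation (\<lambda>\<omega>. G (U \<omega>, W \<omega>))"
proof -
  let ?UW = "\<lambda>\<omega>. (U \<omega>, W \<omega>)"
  define \<R> where "\<R> = {U -` B \<inter> W -` C \<inter> space M | B C. B \<in> sets T \<and> C \<in> sets S}"
  have \<R>_events: "\<R> \<subseteq> events"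
  proof
    fix a assume "a \<in> \<R>"
    then obtain B C where "B \<in> sets T" "C \<in> sets S"
      and a: "a = (U -` B \<inter> space M) \<inter> (W -` C \<inter> space M)" by (auto simp: \<R>_def)
    then show "a \<in> events"
      unfolding a by (intro sets.Int measurable_sets[OF U] measurable_sets[OF W])
  qed
  have "Int_stable \<R>"
    unfolding Int_stable_def
  proof safe
    fix a b assume "a \<in> \<R>" "b \<in> \<R>"
    then obtain B C B' C' where "a = U -` B \<inter> W -` C \<inter> space M" "b = U -` B' \<inter> W -` C' \<inter> space M"
      "B \<in> sets T" "C \<in> sets S" "B' \<in> sets T" "C' \<in> sets S" by (auto simp: \<R>_def)
    then show "a \<inter> b \<in> \<R>"
      unfolding \<R>_def by (auto intro!: exI[of _ "B \<inter> B'"] exI[of _ "C \<inter> C'"])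
  qed
  have "indep_set {F} \<R>"
    unfolding indep_sets2_eq using F \<R>_events indep by (auto simp: \<R>_def)
  then have ind: "indep_set (sigma_sets (space M) {F}) (sigma_sets (space M) \<R>)"
    by (rule indep_set_sigma_sets) (simp_all add: \<open>Int_stable \<R>\<close>, simp add: Int_stable_def)
  have "?UW \<in> space M \<rightarrow> space T \<times> space S"
    using measurable_space[OF U] measurable_space[OF W] by auto
  \<comment> \<open>Generating a sigma algebra commutes with taking preimages, so
    \<open>\<R>\<close> generates exactly the preimages of the product sigma algebra.\<close>
  from sigma_sets_vimage_commute[OF this, of "{B \<times> C |B C. B \<in> sets T \<and> C \<in> sets S}"]
  have "{?UW -` E \<inter> space M |E. E \<in> sets (T \<Otimes>\<^sub>M S)} =
    sigma_sets (space M) {?UW -` E \<inter> space M |E. E \<in> {B \<times> C |B C. B \<in> sets T \<and> C \<in> sets S}}"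
    by (simp add: sets_pair_measure)
  also have "{?UW -` E \<inter> space M |E. E \<in> {B \<times> C |B C. B \<in> sets T \<and> C \<in> sets S}} = \<R>"
  proof -
    have vimage_box: "?UW -` (B \<times> C) \<inter> space M = U -` B \<inter> W -` C \<inter> space M" for B C by auto
    show ?thesis unfolding \<R>_def vimage_box[symmetric] by blast
  qed
  finally have \<R>: "sigma_sets (space M) \<R> = {?UW -` E \<inter> space M |E. E \<in> sets (T \<Otimes>\<^sub>M S)}" ..
  have "indep_var borel (indicator F) borel (\<lambda>\<omega>. G (?UW \<omega>))"
    unfolding indep_var_eq
  proof (intro conjI)
    show "indicator F \<in> borel_measurable M" using F by simp
    show "(\<lambda>\<omega>. G (?UW \<omega>)) \<in> borel_measurable M" using int by auto
    have "F \<subseteq> space M" using F by (rule sets.sets_into_space)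
    then have "indicator F -` A \<inter> space M \<in> sigma_sets (space M) {F}" for A :: "real set"
    proof -
      \<comment> \<open>Only membership of 0 and 1 in \<open>A\<close> matters, so just four
        preimages occur.\<close>
      have "indicator F -` A \<inter> space M =
        (if 1 \<in> A then if 0 \<in> A then space M else F else if 0 \<in> A then space M - F else {})"
        using \<open>F \<subseteq> space M\<close> by (auto simp: indicator_def of_bool_def split: if_splits)
      moreover have "space M \<in> sigma_sets (space M) {F}" by (rule sigma_sets_top)
      ultimately show ?thesis by (auto intro: sigma_sets.intros)
    qed
    then have 1: "sigma_sets (space M) {indicator F -` A \<inter> space M |A. A \<in> sets (borel :: real measure)}
      \<subseteq> sigma_sets (space M) {F}"
      by (intro sigma_sets_mono) auto
    have 2: "sigma_sets (space M) {(\<lambda>\<omega>. G (?UW \<omega>)) -` A \<inter> space M |A. A \<in> sets borel}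
      \<subseteq> sigma_sets (space M) \<R>"
    proof (rule sigma_sets_mono, safe)
      fix A :: "real set" assume "A \<in> sets borel"
      then have "G -` A \<inter> space (T \<Otimes>\<^sub>M S) \<in> sets (T \<Otimes>\<^sub>M S)" using G by (rule measurable_sets[rotated])
      moreover have "(\<lambda>\<omega>. G (?UW \<omega>)) -` A \<inter> space M = ?UW -` (G -` A \<inter> space (T \<Otimes>\<^sub>M S)) \<inter> space M"
        using measurable_space[OF U] measurable_space[OF W] by (auto simp: space_pair_measure)
      ultimately show "(\<lambda>\<omega>. G (?UW \<omega>)) -` A \<inter> space M \<in> sigma_sets (space M) \<R>"
        unfolding \<R> by blast
    qed
    show "indep_set (sigma_sets (space M) {indicator F -` A \<inter> space M |A. A \<in> sets (borel :: real measure)})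
      (sigma_sets (space M) {(\<lambda>\<omega>. G (?UW \<omega>)) -` A \<inter> space M |A. A \<in> sets borel})"
      using ind 1 2 unfolding indep_sets2_eq by blast
  qed
  moreover have "integrable M (indicator F :: 'a \<Rightarrow> real)"
    using F by (intro integrable_real_indicator) (auto simp: less_top[symmetric])
  ultimately show ?thesis
    using indep_var_lebesgue_integral[OF _ _ int] F by simp
qed

section \<open>Independence of the available arms from the queue lengths\<close>

context bandit
begin

abbreviation env :: "nat \<Rightarrow> 'w \<Rightarrow> 'n set \<times> (real ^ 'n)" where
  "env t \<omega> \<equiv> (A t \<omega>, X t \<omega>)"

lemma measurable_env [measurable]: "env t \<in> M \<rightarrow>\<^sub>M env_space"
  using A_measurable X_measurable by simp

lemma arms_in_super_arms: "admissible_policy m \<pi> \<Longrightarrow> arms \<pi> \<omega> t \<in> super_arms m (A t \<omega>)"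
  by (simp add: arms_def played_def admissible_policy_def)

lemma measurable_arms:
  "admissible_policy m \<pi> \<Longrightarrow> (\<lambda>\<omega>. arms \<pi> \<omega> t) \<in> M \<rightarrow>\<^sub>M count_space UNIV"
  unfolding arms_def
  by (rule measurable_played) (auto simp: U_measurable A_measurable X_measurable)

lemma integrable_decision:
  assumes "admissible_policy m \<pi>"
  shows "integrable M (\<lambda>\<omega>. decision (arms \<pi> \<omega>) i t)"
proof (rule integrable_const_bound[of _ 1])
  note measurable_arms[OF assms, measurable]
  show "(\<lambda>\<omega>. decision (arms \<pi> \<omega>) i t) \<in> borel_measurable M"
    unfolding decision_def by measurable
qed (simp add: decision_def)

lemma measurable_arms_queue:
  "admissible_policy m \<pi> \<Longrightarrow> (\<lambda>\<omega>. queue r (arms \<pi> \<omega>) i t) \<in> borel_measurable M"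
  by (intro measurable_queue measurable_arms)

lemma integrable_queue_power:
  assumes "admissible_policy m \<pi>" "0 < r $ i" "r $ i < 1"
  shows "integrable M (\<lambda>\<omega>. queue r (arms \<pi> \<omega>) i t ^ n)"
proof (rule integrable_const_bound[of _ "real t ^ n"])
  show "(\<lambda>\<omega>. queue r (arms \<pi> \<omega>) i t ^ n) \<in> borel_measurable M"
    using measurable_arms_queue[OF assms(1)] by measurable
  show "AE \<omega> in M. norm (queue r (arms \<pi> \<omega>) i t ^ n) \<le> real t ^ n"
    using assms(2,3) by (auto simp: norm_power queue_nonneg intro!: AE_I2 power_mono queue_le)
qed

lemmas integrable_queue = integrable_queue_power[of _ _ _ _ 1, simplified]

lemma avail_event: "{\<omega> \<in> space M. A t \<omega> = Z} \<in> events"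
  using measurable_sets[OF A_measurable, of "{Z}" t] by (simp add: vimage_def Int_def conj_commute)

lemma prob_avail: "prob {\<omega> \<in> space M. A t \<omega> = Z} = prob {\<omega> \<in> space M. A 0 \<omega> = Z}"
proof -
  have "prob {\<omega> \<in> space M. A t \<omega> = Z} = measure (distr M env_space (env t)) ({Z} \<times> UNIV)" for t
    by (subst measure_distr) (auto intro!: arg_cong[of _ _ prob] pair_measureI)
  then show ?thesis using env_identical[of t] by simp
qed

text \<open>Exactly one indicator is nonzero. Splitting over \<open>Z\<close> replaces the random
  set by constants, so that independence can be applied to each term; \<open>f\<close> may be built
  from queue lengths at the fixed outcome.\<close>

lemma avail_cases:
  assumes "\<omega> \<in> space M"
  shows "f (A t \<omega>) = (\<Sum>Z\<in>UNIV. indicator {\<omega> \<in> space M. A t \<omega> = Z} \<omega> * (f Z :: real))"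
  using assms by (simp add: indicator_def if_distrib[of "\<lambda>x. x * _"] cong: if_cong)

text \<open>Two independence assumptions are combined: \<open>U_indep\<close> splits off the seed
  from the whole environment, \<open>env_indep\<close> separates round \<open>t\<close> from the
  earlier rounds, and then the seed is joined to the past again.\<close>

lemma avail_indep:
  fixes t :: nat
  defines "W \<equiv> \<lambda>\<omega>. \<lambda>k\<in>{..<t}. env k \<omega>"
  assumes B: "B \<in> sets borel" and C: "C \<in> sets (\<Pi>\<^sub>M k\<in>{..<t}. env_space)"
  shows "prob ({\<omega> \<in> space M. A t \<omega> = Z} \<inter> (U -` B \<inter> W -` C \<inter> space M)) =
    prob {\<omega> \<in> space M. A t \<omega> = Z} * prob (U -` B \<inter> W -` C \<inter> space M)"
proof -
  let ?F = "{\<omega> \<in> space M. A t \<omega> = Z}"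
  have UB: "U -` B \<inter> space M \<in> sets (vimage_algebra (space M) U borel)"
    using B by (rule in_vimage_algebra)
  have U_env: "prob ((U -` B \<inter> space M) \<inter> ((\<lambda>\<omega> t. env t \<omega>) -` D \<inter> space M)) =
      prob (U -` B \<inter> space M) * prob ((\<lambda>\<omega> t. env t \<omega>) -` D \<inter> space M)"
    if "D \<in> sets (\<Pi>\<^sub>M t\<in>UNIV. env_space)" for D :: "(nat \<Rightarrow> 'n set \<times> (real ^ 'n)) set"
    using indep_setD[OF U_indep UB in_vimage_algebra[OF that]] .
  \<comment> \<open>\<open>D\<close> and \<open>D'\<close> restate the event of the past, without
    and with the condition on round \<open>t\<close>, as sets of entire environment sequences, the
    form to which \<open>U_indep\<close> applies.\<close>
  define D where "D = {e \<in> space (\<Pi>\<^sub>M k\<in>UNIV. (env_space :: ('n set \<times> (real ^ 'n)) measure)). restrict e {..<t} \<in> C}"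
  define D' where "D' = {e \<in> D. fst (e t) = Z}"
  have [measurable]: "D \<in> sets (\<Pi>\<^sub>M k\<in>UNIV. env_space)"
    using C measurable_restrict_subset[of "{..<t}" UNIV "\<lambda>_. env_space :: ('n set \<times> (real ^ 'n)) measure"]
    unfolding D_def by measurable
  have D'_eq: "D' = {e \<in> space (\<Pi>\<^sub>M k\<in>UNIV. env_space). e \<in> D \<and> fst (e t) = Z}"
    by (auto simp: D'_def D_def)
  have D': "D' \<in> sets (\<Pi>\<^sub>M k\<in>UNIV. env_space)"
    unfolding D'_eq by measurable
  have WD: "(\<lambda>\<omega> t. env t \<omega>) -` D \<inter> space M = W -` C \<inter> space M"
    by (auto simp: D_def W_def space_PiM space_pair_measure)
  have WD': "(\<lambda>\<omega> t. env t \<omega>) -` D' \<inter> space M = ?F \<inter> (W -` C \<inter> space M)"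
    using WD by (auto simp: D'_def)
  have "prob (?F \<inter> (W -` C \<inter> space M)) = prob ?F * prob (W -` C \<inter> space M)"
  proof -
    let ?H = "{e \<in> space (\<Pi>\<^sub>M k\<in>{t}. (env_space :: ('n set \<times> (real ^ 'n)) measure)). fst (e t) = Z}"
    \<comment> \<open>The index blocks \<open>{t}\<close> and \<open>{..<t}\<close> are disjoint, so
      the grouped variables are independent.\<close>
    have "indep_var (\<Pi>\<^sub>M k\<in>{t}. env_space) (\<lambda>\<omega>. \<lambda>k\<in>{t}. env k \<omega>) (\<Pi>\<^sub>M k\<in>{..<t}. env_space) W"
      unfolding W_def by (rule indep_var_restrict[OF env_indep]) auto
    moreover have "?H \<in> sets (\<Pi>\<^sub>M k\<in>{t}. env_space)" by measurable
    ultimately have "prob ((\<lambda>\<omega>. (\<lambda>k\<in>{t}. env k \<omega>, W \<omega>)) -` (?H \<times> C) \<inter> space M) =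
        prob ((\<lambda>\<omega>. \<lambda>k\<in>{t}. env k \<omega>) -` ?H \<inter> space M) * prob (W -` C \<inter> space M)"
      using C by (rule indep_varD)
    moreover have "(\<lambda>\<omega>. \<lambda>k\<in>{t}. env k \<omega>) -` ?H \<inter> space M = ?F"
      by (auto simp: space_PiM space_pair_measure)
    moreover have "(\<lambda>\<omega>. (\<lambda>k\<in>{t}. env k \<omega>, W \<omega>)) -` (?H \<times> C) \<inter> space M = ?F \<inter> (W -` C \<inter> space M)"
      by (auto simp: space_PiM space_pair_measure)
    ultimately show ?thesis by simp
  qed
  moreover have "?F \<inter> (U -` B \<inter> W -` C \<inter> space M) = (U -` B \<inter> space M) \<inter> (?F \<inter> (W -` C \<inter> space M))"
    "U -` B \<inter> W -` C \<inter> space M = (U -` B \<inter> space M) \<inter> (W -` C \<inter> space M)" by auto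
  ultimately show ?thesis
    using U_env[OF D'] U_env[of D] unfolding WD WD' by simp
qed

lemma max_weight_queue_le:
  fixes r :: "real ^ 'n"
  assumes "\<And>i. 0 < r $ i \<and> r $ i < 1"
  shows "max_weight m Z (\<lambda>i. queue r S i t) \<le> real CARD('n) * real t"
proof (rule max_weight_le)
  fix T :: "'n set"
  have "(\<Sum>i\<in>T. queue r S i t) \<le> (\<Sum>i\<in>UNIV. queue r S i t)"
    by (rule sum_mono2) (auto simp: queue_nonneg)
  also have "\<dots> \<le> (\<Sum>i\<in>(UNIV :: 'n set). real t)"
    using assms by (intro sum_mono queue_le) (auto simp: less_imp_le)
  finally show "(\<Sum>i\<in>T. queue r S i t) \<le> real CARD('n) * real t" by simp
qed

lemma integrable_max_weight_queue:
  assumes "admissible_policy m \<pi>" "\<And>i. 0 < r $ i \<and> r $ i < 1"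
  shows "integrable M (\<lambda>\<omega>. max_weight m Z (\<lambda>i. queue r (arms \<pi> \<omega>) i t))"
  using measurable_max_weight[OF measurable_arms_queue[OF assms(1)]]
  by (intro integrable_const_bound[of _ "real CARD('n) * real t"])
     (simp_all add: max_weight_nonneg max_weight_queue_le[OF assms(2)])

text \<open>The queue lengths at \<open>t\<close> are a function of the seed and of the rounds
  before \<open>t\<close>, while the event concerns round \<open>t\<close> alone. With
  \<open>Z\<close> fixed, the second factor does not involve \<open>A t\<close>.\<close>

lemma expectation_avail_max_weight:
  assumes \<pi>: "admissible_policy m \<pi>" and r: "\<And>i. 0 < r $ i \<and> r $ i < 1"
  shows "expectation (\<lambda>\<omega>. indicator {\<omega> \<in> space M. A t \<omega> = Z} \<omega> * max_weight m Z (\<lambda>i. queue r (arms \<pi> \<omega>) i t)) =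
    prob {\<omega> \<in> space M. A t \<omega> = Z} * expectation (\<lambda>\<omega>. max_weight m Z (\<lambda>i. queue r (arms \<pi> \<omega>) i t))"
proof -
  let ?N = "borel \<Otimes>\<^sub>M (\<Pi>\<^sub>M k\<in>{..<t}. (env_space :: ('n set \<times> (real ^ 'n)) measure))"
  define W where "W = (\<lambda>\<omega>. \<lambda>k\<in>{..<t}. env k \<omega>)"
  \<comment> \<open>The policy is rerun on the seed and the truncated environment. The result agrees
    with \<open>arms\<close> in the rounds before \<open>t\<close>, which are the only ones that
    enter the queues at \<open>t\<close>.\<close>
  define S where "S = (\<lambda>(u, e). played \<pi> u (\<lambda>k. fst (e k)) (\<lambda>k. snd (e k)) :: nat \<Rightarrow> 'n set)"
  define G where "G p = max_weight m Z (\<lambda>i. queue r (S p) i t)" for p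
  have S: "(\<lambda>p. S p k) \<in> ?N \<rightarrow>\<^sub>M count_space UNIV" if "k < t" for k
    unfolding S_def split_beta
    using that by (intro measurable_played[OF \<pi>]) (simp_all, measurable)
  have G: "G \<in> borel_measurable ?N"
    unfolding G_def by (intro measurable_max_weight measurable_queue S)
  have "S (U \<omega>, W \<omega>) k = arms \<pi> \<omega> k" if "k < t" for k \<omega>
    unfolding S_def arms_def prod.case using that by (intro played_cong) (auto simp: W_def)
  then have G_eq: "G (U \<omega>, W \<omega>) = max_weight m Z (\<lambda>i. queue r (arms \<pi> \<omega>) i t)" for \<omega>
    unfolding G_def by (intro arg_cong[of _ _ "max_weight m Z"] ext queue_cong)
  have "expectation (\<lambda>\<omega>. indicator {\<omega> \<in> space M. A t \<omega> = Z} \<omega> * G (U \<omega>, W \<omega>)) =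
      prob {\<omega> \<in> space M. A t \<omega> = Z} * expectation (\<lambda>\<omega>. G (U \<omega>, W \<omega>))"
  proof (rule expectation_indicator_times_indep[OF avail_event U_measurable])
    show "W \<in> M \<rightarrow>\<^sub>M (\<Pi>\<^sub>M k\<in>{..<t}. env_space)"
      unfolding W_def by (rule measurable_restrict) simp
    show "integrable M (\<lambda>\<omega>. G (U \<omega>, W \<omega>))"
      unfolding G_eq using \<pi> r by (rule integrable_max_weight_queue)
  qed (simp_all only: W_def avail_indep G)
  then show ?thesis by (simp add: G_eq)
qed

section \<open>The expected maximal weight and its comparison with feasible vectors\<close>

text \<open>The law of the available set is averaged out by a finite sum over fixed sets, so that
  random queue lengths can be substituted for \<open>q\<close> afterwards.\<close>

definition mean_max_weight :: "('n \<Rightarrow> real) \<Rightarrow> real" where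
  "mean_max_weight q = (\<Sum>Z\<in>UNIV. prob {\<omega> \<in> space M. A 0 \<omega> = Z} * max_weight m Z q)"

lemma integrable_max_weight: "integrable M (\<lambda>\<omega>. max_weight m (A t \<omega>) q)"
proof (rule integrable_const_bound[of _ "Max (range (\<lambda>Z. max_weight m Z q))"])
  show "(\<lambda>\<omega>. max_weight m (A t \<omega>) q) \<in> borel_measurable M"
    using measurable_compose_countable[OF _ A_measurable] by simp
qed (simp add: max_weight_nonneg)

lemma expectation_max_weight: "expectation (\<lambda>\<omega>. max_weight m (A t \<omega>) q) = mean_max_weight q"
proof -
  have int: "integrable M (\<lambda>\<omega>. indicator {\<omega> \<in> space M. A t \<omega> = Z} \<omega> * max_weight m Z q)" for Z
    using integrable_mult_indicator[OF avail_event, of "\<lambda>_. max_weight m Z q"] by simp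
  have "expectation (\<lambda>\<omega>. max_weight m (A t \<omega>) q) =
      expectation (\<lambda>\<omega>. \<Sum>Z\<in>UNIV. indicator {\<omega> \<in> space M. A t \<omega> = Z} \<omega> * max_weight m Z q)"
    by (rule Bochner_Integration.integral_cong[OF refl avail_cases[where f="\<lambda>Z. max_weight m Z q"]])
  also have "\<dots> = (\<Sum>Z\<in>UNIV. expectation (\<lambda>\<omega>. indicator {\<omega> \<in> space M. A t \<omega> = Z} \<omega> * max_weight m Z q))"
    by (rule Bochner_Integration.integral_sum) (rule int)
  also have "\<dots> = (\<Sum>Z\<in>UNIV. prob {\<omega> \<in> space M. A t \<omega> = Z} * max_weight m Z q)"
    using avail_event by (simp add: Int_absorb1)
  finally show ?thesis by (simp add: prob_avail[of t] mean_max_weight_def)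
qed

text \<open>By independence, the availability of round \<open>t\<close> can be averaged out with the
  queue lengths held fixed. This plays the role of conditioning on the queue lengths, carried out
  set by set.\<close>

lemma
  assumes \<pi>: "admissible_policy m \<pi>" and r: "\<And>i. 0 < r $ i \<and> r $ i < 1"
  shows integrable_mean_max_weight_queue:
      "integrable M (\<lambda>\<omega>. mean_max_weight (\<lambda>i. queue r (arms \<pi> \<omega>) i t))" (is ?int)
    and integrable_avail_max_weight_queue:
      "integrable M (\<lambda>\<omega>. max_weight m (A t \<omega>) (\<lambda>i. queue r (arms \<pi> \<omega>) i t))" (is ?int')
    and expectation_max_weight_queue:
      "expectation (\<lambda>\<omega>. max_weight m (A t \<omega>) (\<lambda>i. queue r (arms \<pi> \<omega>) i t)) =
       expectation (\<lambda>\<omega>. mean_max_weight (\<lambda>i. queue r (arms \<pi> \<omega>) i t))" (is ?eq)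
proof -
  note int = integrable_max_weight_queue[OF \<pi> r]
  have int_ind: "integrable M (\<lambda>\<omega>. indicator {\<omega> \<in> space M. A t \<omega> = Z} \<omega> * max_weight m Z (\<lambda>i. queue r (arms \<pi> \<omega>) i t))" for Z
    using integrable_mult_indicator[OF avail_event int] by simp
  show ?int unfolding mean_max_weight_def using int by auto
  have cases: "max_weight m (A t \<omega>) (\<lambda>i. queue r (arms \<pi> \<omega>) i t) =
      (\<Sum>Z\<in>UNIV. indicator {\<omega> \<in> space M. A t \<omega> = Z} \<omega> * max_weight m Z (\<lambda>i. queue r (arms \<pi> \<omega>) i t))"
    if "\<omega> \<in> space M" for \<omega>
    using avail_cases[OF that, of "\<lambda>Z. max_weight m Z (\<lambda>i. queue r (arms \<pi> \<omega>) i t)"] .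
  show ?int'
    by (subst Bochner_Integration.integrable_cong[OF refl cases], assumption)
       (rule Bochner_Integration.integrable_sum, rule int_ind)
  have "expectation (\<lambda>\<omega>. max_weight m (A t \<omega>) (\<lambda>i. queue r (arms \<pi> \<omega>) i t)) =
      (\<Sum>Z\<in>UNIV. prob {\<omega> \<in> space M. A t \<omega> = Z} * expectation (\<lambda>\<omega>. max_weight m Z (\<lambda>i. queue r (arms \<pi> \<omega>) i t)))"
    unfolding expectation_avail_max_weight[OF \<pi> r, symmetric]
    by (subst Bochner_Integration.integral_cong[OF refl cases], assumption)
       (rule Bochner_Integration.integral_sum, rule int_ind)
  also have "\<dots> = expectation (\<lambda>\<omega>. mean_max_weight (\<lambda>i. queue r (arms \<pi> \<omega>) i t))"
    unfolding mean_max_weight_def using int by (simp add: prob_avail[of t])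
  finally show ?eq .
qed

text \<open>
  Averaging over finitely many rounds of a witnessing policy achieves \<open>r\<close> up to an arbitrarily
  small error, so no stationary randomized policy has to be extracted as a limit.
\<close>

lemma feasible_le_mean_max_weight:
  assumes r: "r \<in> feasible_region" and q: "\<And>i. 0 \<le> q i"
  shows "(\<Sum>i\<in>UNIV. q i * r $ i) \<le> mean_max_weight q"
proof (rule field_le_epsilon)
  fix e :: real assume "e > 0"
  define Q where "Q = (\<Sum>i\<in>UNIV. q i)"
  have "Q \<ge> 0" using q by (simp add: Q_def sum_nonneg)
  \<comment> \<open>The total error \<open>Q * \<delta>\<close> must stay below \<open>e\<close>;
    adding 1 keeps the denominator positive when all weights vanish.\<close>
  define \<delta> where "\<delta> = e / (Q + 1)"
  have "\<delta> > 0" "Q * \<delta> \<le> e" using \<open>e > 0\<close> \<open>Q \<ge> 0\<close> by (auto simp: \<delta>_def field_simps)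
  obtain \<pi> where \<pi>: "admissible_policy m \<pi>" and fair: "fairness r \<pi>"
    using r by (auto simp: feasible_region_def)
  define avg where "avg i T = (\<Sum>t<T. expectation (\<lambda>\<omega>. decision (arms \<pi> \<omega>) i t)) / real T" for i T
  have "ereal (r $ i - \<delta>) < liminf (\<lambda>T. ereal (avg i T))" for i
    using fair \<open>\<delta> > 0\<close> less_le_trans[of "ereal (r $ i - \<delta>)" "ereal (r $ i)"]
    by (auto simp: fairness_def avg_def)
  \<comment> \<open>There are finitely many arms, so one horizon \<open>T\<close> serves all of
    them.\<close>
  then have "\<forall>\<^sub>F T in sequentially. \<forall>i. r $ i - \<delta> < avg i T"
    using less_LiminfD by (fastforce intro!: eventually_all_finite)
  from eventually_conj[OF this eventually_gt_at_top[of 0]]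
  obtain T where T: "\<And>i. r $ i - \<delta> < avg i T" "T > 0"
    using eventually_happens'[OF sequentially_bot] by blast
  have le: "(\<Sum>i\<in>UNIV. q i * expectation (\<lambda>\<omega>. decision (arms \<pi> \<omega>) i t)) \<le> mean_max_weight q" for t
  proof -
    have "(\<Sum>i\<in>UNIV. q i * expectation (\<lambda>\<omega>. decision (arms \<pi> \<omega>) i t)) =
        expectation (\<lambda>\<omega>. \<Sum>i\<in>UNIV. q i * decision (arms \<pi> \<omega>) i t)"
      using integrable_decision[OF \<pi>] by (subst Bochner_Integration.integral_sum) auto
    \<comment> \<open>However it uses the past, a policy plays a feasible super arm of the current
      round, whose weight is at most the maximal one.\<close>
    also have "\<dots> \<le> expectation (\<lambda>\<omega>. max_weight m (A t \<omega>) q)"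
    proof (rule integral_mono)
      show "integrable M (\<lambda>\<omega>. \<Sum>i\<in>UNIV. q i * decision (arms \<pi> \<omega>) i t)"
        using integrable_decision[OF \<pi>] by auto
      show "integrable M (\<lambda>\<omega>. max_weight m (A t \<omega>) q)"
        by (rule integrable_max_weight)
      show "(\<Sum>i\<in>UNIV. q i * decision (arms \<pi> \<omega>) i t) \<le> max_weight m (A t \<omega>) q" for \<omega>
        using sum_le_max_weight[OF arms_in_super_arms[OF \<pi>], of q \<omega> t]
        by (simp add: decision_def if_distrib[of "\<lambda>x. _ * x"] sum.If_cases cong: if_cong)
    qed
    finally show ?thesis by (simp add: expectation_max_weight)
  qed
  have "(\<Sum>i\<in>UNIV. q i * r $ i) - Q * \<delta> = (\<Sum>i\<in>UNIV. q i * (r $ i - \<delta>))"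
    by (simp add: Q_def sum_distrib_right right_diff_distrib sum_subtractf)
  also have "\<dots> \<le> (\<Sum>i\<in>UNIV. q i * avg i T)"
    using T(1) q by (intro sum_mono mult_left_mono) (auto simp: less_imp_le)
  also have "\<dots> = (\<Sum>t<T. \<Sum>i\<in>UNIV. q i * expectation (\<lambda>\<omega>. decision (arms \<pi> \<omega>) i t)) / real T"
    by (subst sum.swap) (simp add: avg_def sum_divide_distrib sum_distrib_left)
  also have "\<dots> \<le> (\<Sum>t<T. mean_max_weight q) / real T"
    by (intro divide_right_mono sum_mono le) simp
  also have "\<dots> = mean_max_weight q" using T(2) by simp
  finally show "(\<Sum>i\<in>UNIV. q i * r $ i) \<le> mean_max_weight q + e"
    using \<open>Q * \<delta> \<le> e\<close> by simp
qed

section \<open>Lyapunov drift of LFG\<close>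

text \<open>Compare any feasible super arm with the one played under the LFG objective. On the
  competitor's side the nonnegative UCB terms are dropped; on the played side there are at most
  \<open>m\<close> of them, each at most \<open>\<eta> * w_max\<close>.\<close>

lemma LFG_max_weight_le:
  assumes LFG: "LFG \<eta> w r \<pi>" and \<eta>: "\<eta> > 0" and w: "\<And>i. 0 < w i \<and> w i \<le> w_max"
    and \<omega>: "\<omega> \<in> space M"
  shows "max_weight m (A t \<omega>) (\<lambda>i. queue r (arms \<pi> \<omega>) i t) \<le>
    (\<Sum>i\<in>UNIV. queue r (arms \<pi> \<omega>) i t * decision (arms \<pi> \<omega>) i t) + \<eta> * real m * w_max"
proof (rule max_weight_le)
  let ?Q = "\<lambda>i. queue r (arms \<pi> \<omega>) i t"
  let ?u = "\<lambda>i. \<eta> * w i * ucb (arms \<pi> \<omega>) (\<lambda>k. X k \<omega>) i t"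
  let ?S = "arms \<pi> \<omega> t"
  fix S assume S: "S \<in> super_arms m (A t \<omega>)"
  have "0 \<le> X k \<omega> $ i" for k i
    using X_range[OF \<omega>, of k i] by simp
  then have u_nonneg: "0 \<le> ?u i" for i
    using \<eta> w[of i] by (intro mult_nonneg_nonneg ucb_nonneg) (auto simp: less_imp_le)
  have u_le: "?u i \<le> \<eta> * w_max" for i
  proof -
    have "?u i \<le> \<eta> * w i * 1"
      using \<eta> w[of i] ucb_le_1 by (intro mult_left_mono) (auto simp: less_imp_le)
    also have "\<dots> \<le> \<eta> * w_max" using \<eta> w[of i] by simp
    finally show ?thesis .
  qed
  have max: "is_arg_max (\<lambda>S. \<Sum>i\<in>S. ?Q i + ?u i) (\<lambda>S. S \<in> super_arms m (A t \<omega>)) ?S"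
    using LFG \<omega> by (simp add: LFG_def)
  have "0 \<le> \<eta> * w_max" using u_nonneg u_le order_trans by blast
  have "sum ?Q S \<le> (\<Sum>i\<in>S. ?Q i + ?u i)"
    using u_nonneg by (intro sum_mono) simp
  also have "\<dots> \<le> (\<Sum>i\<in>?S. ?Q i + ?u i)"
    using max S by (auto simp: is_arg_max_def not_less)
  also have "\<dots> = (\<Sum>i\<in>?S. ?Q i) + (\<Sum>i\<in>?S. ?u i)" by (rule sum.distrib)
  also have "(\<Sum>i\<in>?S. ?u i) \<le> real (card ?S) * (\<eta> * w_max)"
    using u_le by (rule sum_bounded_above)
  also have "\<dots> \<le> real m * (\<eta> * w_max)"
    using max \<open>0 \<le> \<eta> * w_max\<close>
    by (intro mult_right_mono) (auto simp: is_arg_max_def super_arms_def)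
  also have "(\<Sum>i\<in>?S. ?Q i) = (\<Sum>i\<in>UNIV. ?Q i * decision (arms \<pi> \<omega>) i t)"
    by (simp add: decision_def if_distrib[of "\<lambda>x. _ * x"] sum.If_cases cong: if_cong)
  finally show "sum ?Q S \<le> (\<Sum>i\<in>UNIV. ?Q i * decision (arms \<pi> \<omega>) i t) + \<eta> * real m * w_max"
    by (simp add: ac_simps)
qed

definition mean_queue :: "real ^ 'n \<Rightarrow> 'n policy \<Rightarrow> 'n \<Rightarrow> nat \<Rightarrow> real" where
  "mean_queue r \<pi> i t = expectation (\<lambda>\<omega>. queue r (arms \<pi> \<omega>) i t)"

text \<open>The expectation is built in, so the drift inequality compares numbers and is not
  conditional on the queue state.\<close>

definition lyapunov :: "real ^ 'n \<Rightarrow> 'n policy \<Rightarrow> nat \<Rightarrow> real" where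
  "lyapunov r \<pi> t = expectation (\<lambda>\<omega>. \<Sum>i\<in>UNIV. (queue r (arms \<pi> \<omega>) i t)\<^sup>2 / 2)"

text \<open>The comparison vector \<open>r'\<close> is left free: a shift of \<open>r\<close> by a
  positive slack gives negative drift for long queues, and \<open>r\<close> itself gives a bounded
  increase per round.\<close>

lemma lyapunov_drift:
  assumes LFG: "LFG \<eta> w r \<pi>" and \<eta>: "\<eta> > 0" and w: "\<And>i. 0 < w i \<and> w i \<le> w_max"
    and r: "\<And>i. 0 < r $ i \<and> r $ i < 1" and r': "r' \<in> feasible_region"
  shows "lyapunov r \<pi> (Suc t) \<le> lyapunov r \<pi> t + (real CARD('n) / 2 + \<eta> * real m * w_max)
    - (\<Sum>i\<in>UNIV. mean_queue r \<pi> i t * (r' $ i - r $ i))"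
proof -
  have \<pi>: "admissible_policy m \<pi>" using LFG by (simp add: LFG_def)
  let ?B = "real CARD('n) / 2 + \<eta> * real m * w_max"
  let ?Q = "\<lambda>\<omega> i. queue r (arms \<pi> \<omega>) i t"
  let ?V = "\<lambda>t \<omega>. \<Sum>i\<in>UNIV. (queue r (arms \<pi> \<omega>) i t)\<^sup>2 / 2"
  have int_Q: "integrable M (\<lambda>\<omega>. ?Q \<omega> i)" for i
    using integrable_queue \<pi> r by blast
  have int_V: "integrable M (?V t)" for t
    using integrable_queue_power[OF \<pi>] r by (intro Bochner_Integration.integrable_sum) simp
  have int_Qr: "integrable M (\<lambda>\<omega>. \<Sum>i\<in>UNIV. ?Q \<omega> i * r $ i)" for r :: "real ^ 'n"
    using int_Q by (intro Bochner_Integration.integrable_sum) simp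
  note int_max = integrable_avail_max_weight_queue[OF \<pi> r]
  \<comment> \<open>Outcome by outcome, the service received is exchanged for the maximal weight,
    which accounts for the second term of \<open>?B\<close>.\<close>
  have step: "?V (Suc t) \<omega> \<le> ?V t \<omega> + ?B + (\<Sum>i\<in>UNIV. ?Q \<omega> i * r $ i) - max_weight m (A t \<omega>) (?Q \<omega>)"
    if "\<omega> \<in> space M" for \<omega>
  proof -
    have "?V (Suc t) \<omega> \<le> (\<Sum>i\<in>UNIV. (?Q \<omega> i)\<^sup>2 / 2 + 1 / 2 + ?Q \<omega> i * r $ i - ?Q \<omega> i * decision (arms \<pi> \<omega>) i t)"
      using r by (intro sum_mono queue_square_step) auto
    also have "\<dots> = ?V t \<omega> + real CARD('n) / 2 + (\<Sum>i\<in>UNIV. ?Q \<omega> i * r $ i)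
        - (\<Sum>i\<in>UNIV. ?Q \<omega> i * decision (arms \<pi> \<omega>) i t)"
      by (simp add: sum.distrib sum_subtractf)
    finally show ?thesis
      using LFG_max_weight_le[OF LFG \<eta> w that, of t] by linarith
  qed
  have "lyapunov r \<pi> (Suc t) \<le>
      expectation (\<lambda>\<omega>. ?V t \<omega> + ?B + (\<Sum>i\<in>UNIV. ?Q \<omega> i * r $ i) - max_weight m (A t \<omega>) (?Q \<omega>))"
    unfolding lyapunov_def
    by (rule integral_mono[OF int_V _ step])
       (intro Bochner_Integration.integrable_diff Bochner_Integration.integrable_add int_V int_Qr int_max integrable_const)
  also have "\<dots> = lyapunov r \<pi> t + ?B + expectation (\<lambda>\<omega>. \<Sum>i\<in>UNIV. ?Q \<omega> i * r $ i)
      - expectation (\<lambda>\<omega>. mean_max_weight (?Q \<omega>))"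
    using int_V[of t] int_Qr int_max
    by (simp add: lyapunov_def prob_space expectation_max_weight_queue[OF \<pi> r]
        del: Bochner_Integration.integral_divide_zero)
  finally have le: "lyapunov r \<pi> (Suc t) \<le> lyapunov r \<pi> t + ?B
    + expectation (\<lambda>\<omega>. \<Sum>i\<in>UNIV. ?Q \<omega> i * r $ i) - expectation (\<lambda>\<omega>. mean_max_weight (?Q \<omega>))" .
  \<comment> \<open>The comparison for fixed weights is applied at each outcome, with the queue
    lengths as weights.\<close>
  have ge: "expectation (\<lambda>\<omega>. \<Sum>i\<in>UNIV. ?Q \<omega> i * r' $ i) \<le> expectation (\<lambda>\<omega>. mean_max_weight (?Q \<omega>))"
    by (rule integral_mono[OF int_Qr integrable_mean_max_weight_queue[OF \<pi> r]])
       (rule feasible_le_mean_max_weight[OF r' queue_nonneg])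
  have E_Qr: "expectation (\<lambda>\<omega>. \<Sum>i\<in>UNIV. ?Q \<omega> i * s $ i) = (\<Sum>i\<in>UNIV. mean_queue r \<pi> i t * s $ i)" for s :: "real ^ 'n"
    unfolding mean_queue_def using int_Q by (subst Bochner_Integration.integral_sum) auto
  show ?thesis
    using le ge by (simp add: E_Qr right_diff_distrib sum_subtractf)
qed

section \<open>From the drift to bounded average queues and fairness\<close>

text \<open>The drift telescopes from empty queues. A positive \<open>\<epsilon>\<close> controls
  the average queue; the case \<open>\<epsilon> = 0\<close> says that second moments grow at most
  linearly, and is used for fairness.\<close>

lemma lyapunov_bound:
  assumes LFG: "LFG \<eta> w r \<pi>" and \<eta>: "\<eta> > 0" and w: "\<And>i. 0 < w i \<and> w i \<le> w_max"
    and r: "\<And>i. 0 < r $ i \<and> r $ i < 1" and r': "(\<chi> i. r $ i + \<epsilon>) \<in> feasible_region"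
  shows "lyapunov r \<pi> T + \<epsilon> * (\<Sum>t<T. \<Sum>i\<in>UNIV. mean_queue r \<pi> i t)
    \<le> (real CARD('n) / 2 + \<eta> * real m * w_max) * real T"
proof (induction T)
  case 0
  show ?case by (simp add: lyapunov_def)
next
  case (Suc T)
  have "(\<Sum>i\<in>UNIV. mean_queue r \<pi> i T * ((\<chi> i. r $ i + \<epsilon>) $ i - r $ i)) = \<epsilon> * (\<Sum>i\<in>UNIV. mean_queue r \<pi> i T)"
    by (simp add: sum_distrib_left mult.commute)
  with Suc lyapunov_drift[OF LFG \<eta> w r r', of T] show ?case
    by (simp add: distrib_left)
qed

text \<open>Discard the nonnegative Lyapunov term and divide by \<open>\<epsilon> * T\<close>. The
  bound holds for every horizon \<open>T\<close> from 1 on, hence for the limit superior.\<close>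

lemma avg_queue_le:
  assumes "LFG \<eta> w r \<pi>" "\<eta> > 0" "\<And>i. 0 < w i \<and> w i \<le> w_max"
    and r: "\<And>i. 0 < r $ i \<and> r $ i < 1" and "(\<chi> i. r $ i + \<epsilon>) \<in> feasible_region" and \<epsilon>: "\<epsilon> > 0"
  shows "avg_queue r \<pi> \<le> ereal ((real CARD('n) / 2 + \<eta> * real m * w_max) / \<epsilon>)"
  unfolding avg_queue_def
proof (intro Limsup_bounded eventually_sequentiallyI[of 1])
  fix T :: nat assume "1 \<le> T"
  let ?B = "real CARD('n) / 2 + \<eta> * real m * w_max"
  have \<pi>: "admissible_policy m \<pi>" using assms(1) by (simp add: LFG_def)
  have "expectation (\<lambda>\<omega>. \<Sum>i\<in>UNIV. queue r (arms \<pi> \<omega>) i t) = (\<Sum>i\<in>UNIV. mean_queue r \<pi> i t)" for t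
    unfolding mean_queue_def using r by (intro Bochner_Integration.integral_sum integrable_queue \<pi>) auto
  moreover have "0 \<le> lyapunov r \<pi> T"
    unfolding lyapunov_def by (intro integral_nonneg_AE AE_I2 sum_nonneg) simp
  with lyapunov_bound[OF assms(1-5), of T]
  have "\<epsilon> * (\<Sum>t<T. \<Sum>i\<in>UNIV. mean_queue r \<pi> i t) \<le> ?B * real T" by linarith
  ultimately show "ereal ((\<Sum>t<T. expectation (\<lambda>\<omega>. \<Sum>i\<in>UNIV. queue r (arms \<pi> \<omega>) i t)) / real T) \<le> ereal (?B / \<epsilon>)"
    using \<epsilon> \<open>1 \<le> T\<close> by (simp add: field_simps)
qed

lemma fairness_LFG:
  assumes LFG: "LFG \<eta> w r \<pi>" and \<eta>: "\<eta> > 0" and w: "\<And>i. 0 < w i \<and> w i \<le> w_max"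
    and r: "r \<in> feasible_region"
  shows "fairness r \<pi>"
  unfolding fairness_def
proof
  fix i
  have \<pi>: "admissible_policy m \<pi>" using LFG by (simp add: LFG_def)
  have r01: "0 < r $ i \<and> r $ i < 1" for i using r by (simp add: feasible_region_def)
  define B where "B = real CARD('n) / 2 + \<eta> * real m * w_max"
  note int_pow = integrable_queue_power[OF \<pi> conjunct1[OF r01] conjunct2[OF r01]]
  note int = integrable_queue[OF \<pi> conjunct1[OF r01] conjunct2[OF r01]]
  have mean_le: "mean_queue r \<pi> i T \<le> sqrt (2 * B * real T)" for T
  proof (rule real_le_rsqrt)
    \<comment> \<open>Nonnegativity of the variance bounds the squared mean by the second
      moment.\<close>
    have "(mean_queue r \<pi> i T)\<^sup>2 \<le> expectation (\<lambda>\<omega>. (queue r (arms \<pi> \<omega>) i T)\<^sup>2)"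
      using variance_eq[OF int int_pow] variance_positive unfolding mean_queue_def
      by (metis diff_ge_0_iff_ge)
    also have "\<dots> / 2 = expectation (\<lambda>\<omega>. (queue r (arms \<pi> \<omega>) i T)\<^sup>2 / 2)" by simp
    also have "\<dots> \<le> lyapunov r \<pi> T"
      unfolding lyapunov_def
    proof (rule integral_mono)
      show "(queue r (arms \<pi> \<omega>) i T)\<^sup>2 / 2 \<le> (\<Sum>i\<in>UNIV. (queue r (arms \<pi> \<omega>) i T)\<^sup>2 / 2)" for \<omega>
        by (rule member_le_sum) auto
    qed (use int_pow in auto)
    also have "\<dots> \<le> B * real T"
      \<comment> \<open>With zero slack the shifted vector is \<open>r\<close> itself.\<close>
      using lyapunov_bound[OF LFG \<eta> w r01, of 0 T] r by (simp add: B_def)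
    finally show "(mean_queue r \<pi> i T)\<^sup>2 \<le> 2 * B * real T" by simp
  qed
  have avg_ge: "r $ i - sqrt (2 * B * real T) / real T
      \<le> (\<Sum>t<T. expectation (\<lambda>\<omega>. decision (arms \<pi> \<omega>) i t)) / real T" if "T > 0" for T
  proof -
    \<comment> \<open>The expected deficit after \<open>T\<close> rounds is at most the mean queue
      length, so its average per round is of order \<open>1 / sqrt T\<close>.\<close>
    have "real T * r $ i - (\<Sum>t<T. expectation (\<lambda>\<omega>. decision (arms \<pi> \<omega>) i t)) =
        expectation (\<lambda>\<omega>. real T * r $ i - (\<Sum>t<T. decision (arms \<pi> \<omega>) i t))"
      using integrable_decision[OF \<pi>] by (simp add: prob_space)
    also have "\<dots> \<le> mean_queue r \<pi> i T"
      unfolding mean_queue_def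
      using integrable_decision[OF \<pi>] by (intro integral_mono queue_ge int) auto
    also note mean_le
    finally have "(real T * r $ i - (\<Sum>t<T. expectation (\<lambda>\<omega>. decision (arms \<pi> \<omega>) i t))) / real T
        \<le> sqrt (2 * B * real T) / real T"
      by (rule divide_right_mono) simp
    then show ?thesis using that by (simp add: diff_divide_distrib)
  qed
  have "(\<lambda>T. r $ i - sqrt (2 * B) * inverse (sqrt (real T))) \<longlonglongrightarrow> r $ i - sqrt (2 * B) * 0"
    by (intro tendsto_intros tendsto_inverse_0_at_top filterlim_compose[OF sqrt_at_top] filterlim_real_sequentially)
  then have "(\<lambda>T. ereal (r $ i - sqrt (2 * B) * inverse (sqrt (real T)))) \<longlonglongrightarrow> ereal (r $ i)"
    by simp
  then have "ereal (r $ i) = liminf (\<lambda>T. ereal (r $ i - sqrt (2 * B) * inverse (sqrt (real T))))"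
    by (rule lim_imp_Liminf[OF sequentially_bot, symmetric])
  also have "\<dots> \<le> liminf (\<lambda>T. ereal ((\<Sum>t<T. expectation (\<lambda>\<omega>. decision (arms \<pi> \<omega>) i t)) / real T))"
  proof (intro Liminf_mono eventually_sequentiallyI[of 1])
    fix T :: nat assume "1 \<le> T"
    then have "sqrt (2 * B * real T) / real T = sqrt (2 * B) * inverse (sqrt (real T))"
      by (simp add: real_sqrt_mult field_simps)
    then show "ereal (r $ i - sqrt (2 * B) * inverse (sqrt (real T)))
        \<le> ereal ((\<Sum>t<T. expectation (\<lambda>\<omega>. decision (arms \<pi> \<omega>) i t)) / real T)"
      using avg_ge[of T] \<open>1 \<le> T\<close> by simp
  qed
  finally show "ereal (r $ i) \<le> liminf (\<lambda>T. ereal ((\<Sum>t<T. expectation (\<lambda>\<omega>. decision (arms \<pi> \<omega>) i t)) / real T))" .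
qed

end

section \<open>Slack at interior points and conclusion\<close>

text \<open>The interior is open and the diagonal shift is continuous in its size. This supplies the
  slack for strong stability, whose statement mentions none.\<close>

lemma interior_diagonal_shift:
  fixes r :: "real ^ 'n::finite"
  assumes "r \<in> interior C"
  obtains \<epsilon> where "\<epsilon> > 0" "(\<chi> i. r $ i + \<epsilon>) \<in> interior C"
proof -
  have "((\<lambda>e. \<chi> i. r $ i + e) \<longlongrightarrow> (\<chi> i. r $ i + 0)) (at_right 0)"
    by (intro tendsto_intros)
  then have "((\<lambda>e. \<chi> i. r $ i + e) \<longlongrightarrow> r) (at_right 0)" by simp
  then have "\<forall>\<^sub>F e in at_right 0. (\<chi> i. r $ i + e) \<in> interior C"
    using assms by (rule topological_tendstoD[OF _ open_interior])
  then have "\<forall>\<^sub>F e in at_right (0::real). 0 < e \<and> (\<chi> i. r $ i + e) \<in> interior C"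
    using eventually_at_right_less[of "0::real"] by eventually_elim simp
  then show thesis
    using eventually_happens'[OF trivial_limit_at_right_real] that by blast
qed

theorem theorem1:
  fixes M :: "'w measure"
    and A :: "nat \<Rightarrow> 'w \<Rightarrow> 'n::finite set"
    and X :: "nat \<Rightarrow> 'w \<Rightarrow> real ^ 'n"
    and U :: "'w \<Rightarrow> real"
    and m :: nat
    and \<eta> w_max :: real
    and w :: "'n \<Rightarrow> real"
    and pol :: "real ^ 'n \<Rightarrow> 'n policy"
  assumes "bandit M A X U m"
    and "\<eta> > 0"
    and "\<And>i. 0 < w i \<and> w i \<le> w_max"
    and "\<And>r. (\<forall>i. 0 < r $ i \<and> r $ i < 1) \<Longrightarrow> bandit.LFG M A X U m \<eta> w r (pol r)"
  shows "bandit.feasibility_optimal M A X U m pol \<and>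
    (\<forall>r \<in> interior (bandit.feasible_region M A X U m).
       bandit.strongly_stable M A X U r (pol r) \<and>
       (\<forall>\<epsilon>>0. (\<chi> i. r $ i + \<epsilon>) \<in> interior (bandit.feasible_region M A X U m) \<longrightarrow>
          bandit.avg_queue M A X U r (pol r)
            \<le> ereal ((real CARD('n) / 2 + \<eta> * real m * w_max) / \<epsilon>)))"
proof -
  interpret bandit M A X U m by fact
  have LFG: "LFG \<eta> w r (pol r)" "\<And>i. 0 < r $ i \<and> r $ i < 1" "r \<in> feasible_region"
    if "r \<in> interior feasible_region" for r
    using interior_subset[of feasible_region] assms(4)[of r] that by (auto simp: feasible_region_def)
  have bound: "avg_queue r (pol r) \<le> ereal ((real CARD('n) / 2 + \<eta> * real m * w_max) / \<epsilon>)"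
    if "r \<in> interior feasible_region" "\<epsilon> > 0" "(\<chi> i. r $ i + \<epsilon>) \<in> interior feasible_region" for r \<epsilon>
    using avg_queue_le[OF LFG(1)[OF that(1)] assms(2,3) LFG(2)[OF that(1)] LFG(3)[OF that(3)] that(2)] .
  have "fairness r (pol r)" if "r \<in> interior feasible_region" for r
    using fairness_LFG[OF LFG(1)[OF that] assms(2,3) LFG(3)[OF that]] .
  moreover have "strongly_stable r (pol r)" if r: "r \<in> interior feasible_region" for r
  proof -
    \<comment> \<open>Any one admissible slack gives a finite bound.\<close>
    obtain \<epsilon> where "\<epsilon> > 0" "(\<chi> i. r $ i + \<epsilon>) \<in> interior feasible_region"
      by (rule interior_diagonal_shift[OF r])
    from bound[OF r this] show ?thesis
      unfolding strongly_stable_def by (rule le_less_trans) simp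
  qed
  ultimately show ?thesis
    using bound by (auto simp: feasibility_optimal_def)
qed

end
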